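(* For any $\rho, \sigma$ in the gyrovector space $(\mathbb{D}_{n}, \odot, \star)$ and any $t \in [0,1]$, $$L(t; \rho, \sigma) = \frac{1}{\mathrm{tr} (\rho \#_{t} \sigma)} \, \rho \#_{t} \sigma, \qquad L^{c}(t; \rho, \sigma) = \frac{1}{\mathrm{tr} (\rho \natural_{t} \sigma)} \, \rho \natural_{t} \sigma,$$ where $L(t;\rho,\sigma)$ and $L^{c}(t;\rho,\sigma)$ are the gyroline and the cogyroline through $\rho$ and $\sigma$.
   Context: $\mathbb{D}_{n}$ is the set of $n \times n$ invertible density matrices, i.e. positive definite Hermitian complex matrices of trace $1$. For $\rho, \sigma \in \mathbb{D}_n$ and $t \in \mathbb{R}$ put $\rho \odot \sigma := \dfrac{\rho^{1/2} \sigma \rho^{1/2}}{\mathrm{tr}(\rho \sigma)}$ and $t \star \rho := \dfrac{\rho^{t}}{\mathrm{tr}(\rho^{t})}$. Then $(\mathbb{D}_n, \odot, \star)$ is a gyrovector space with identity $\frac{1}{n} I_n$; the inverse of $\rho$ is $\ominus \rho = (-1) \star \rho = \rho^{-1}/\mathrm{tr}(\rho^{-1})$, and its gyroautomorphisms are determined by $\mathrm{gyr}[\rho,\sigma]\tau = \ominus(\rho \odot \sigma) \odot [\rho \odot (\sigma \odot \tau)]$. The gyrogroup cooperation is $\rho \boxdot \sigma := \rho \odot \mathrm{gyr}[\rho, \ominus \sigma] \sigma$. The gyroline is $L(t; \rho, \sigma) := \rho \odot t \star (\ominus \rho \odot \sigma)$ and the cogyroline is $L^{c}(t; \rho, \sigma)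 := t \star (\ominus \rho \boxdot \sigma) \odot \rho$ (the scalar multiplication binds more tightly than $\odot$). For positive definite $A, B$, the weighted geometric mean is $A \#_{t} B := A^{1/2} (A^{-1/2} B A^{-1/2})^{t} A^{1/2}$, with $A \# B := A \#_{1/2} B$, and the weighted spectral geometric mean is $A \natural_{t} B := (A^{-1} \# B)^{t} A (A^{-1} \# B)^{t}$. *)

theory Defs
  imports "HOL-Analysis.Analysis"
begin

section \<open>Hermitian matrices and real powers\<close>

definition cadjoint :: "complex^'n^'n \<Rightarrow> complex^'n^'n" where
  "cadjoint A = map_matrix cnj (transpose A)"

definition hermitian :: "complex^'n^'n \<Rightarrow> bool" where
  "hermitian A \<longleftrightarrow> cadjoint A = A"

definition unitary :: "complex^'n^'n \<Rightarrow> bool" where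
  "unitary U \<longleftrightarrow> cadjoint U ** U = mat 1 \<and> U ** cadjoint U = mat 1"

text \<open>The quadratic form of a Hermitian matrix is real-valued, so taking its real part loses nothing.\<close>
definition positive_definite :: "complex^'n^'n \<Rightarrow> bool" where
  "positive_definite A \<longleftrightarrow>
     hermitian A \<and> (\<forall>x. x \<noteq> 0 \<longrightarrow> 0 < Re (\<Sum>i\<in>UNIV. cnj (x $ i) * (A *v x) $ i))"

definition rdiag :: "('n \<Rightarrow> real) \<Rightarrow> complex^'n^'n" where
  "rdiag d = (\<chi> i j. if i = j then complex_of_real (d i) else 0)"

text \<open>Spectral calculus: for a unitary diagonalization \<open>A = U D U\<^sup>*\<close> with positive
  eigenvalues, \<open>A\<^sup>t = U D\<^sup>t U\<^sup>*\<close>. By \<open>mpow_eqI\<close> below the choice of the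
  diagonalization does not matter; a positive definite \<open>A\<close> has one by the spectral theorem.\<close>
definition mpow :: "complex^'n^'n \<Rightarrow> real \<Rightarrow> complex^'n^'n" where
  "mpow A t = (THE B. \<exists>U d. unitary U \<and> (\<forall>i. 0 < d i) \<and>
      A = U ** rdiag d ** cadjoint U \<and> B = U ** rdiag (\<lambda>i. d i powr t) ** cadjoint U)"

lemma rdiag_mult_left: "(rdiag d ** M) $ i $ j = complex_of_real (d i) * M $ i $ j"
  by (simp add: rdiag_def matrix_matrix_mult_def if_distrib if_distribR cong: if_cong)

lemma rdiag_mult_right: "(M ** rdiag d) $ i $ j = M $ i $ j * complex_of_real (d j)"
  by (simp add: rdiag_def matrix_matrix_mult_def if_distrib if_distribR cong: if_cong)

lemma spectral_calculus_unique:
  assumes U: "unitary U" and V: "unitary V"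
    and eq: "U ** rdiag d ** cadjoint U = V ** rdiag e ** cadjoint V"
  shows "U ** rdiag (\<lambda>i. f (d i)) ** cadjoint U = V ** rdiag (\<lambda>i. f (e i)) ** cadjoint V"
proof -
  define W where "W = cadjoint V ** U"
  have UU: "cadjoint U ** U = mat 1" "U ** cadjoint U = mat 1"
    and VV: "cadjoint V ** V = mat 1" "V ** cadjoint V = mat 1"
    using U V by (auto simp: unitary_def)
  have "cadjoint V ** (U ** rdiag d ** cadjoint U) ** U
      = cadjoint V ** (V ** rdiag e ** cadjoint V) ** U"
    by (simp add: eq)
  moreover have "cadjoint V ** (U ** rdiag d ** cadjoint U) ** U = W ** rdiag d"
    unfolding W_def by (metis UU(1) matrix_mul_assoc matrix_mul_rid)
  moreover have "cadjoint V ** (V ** rdiag e ** cadjoint V) ** U = rdiag e ** W"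
    unfolding W_def by (metis VV(1) matrix_mul_assoc matrix_mul_lid)
  ultimately have "W ** rdiag d = rdiag e ** W" by simp
  then have "W $ i $ j * complex_of_real (d j) = complex_of_real (e i) * W $ i $ j" for i j
    by (metis rdiag_mult_left rdiag_mult_right)
  then have "W $ i $ j = 0 \<or> d j = e i" for i j
    by (metis mult.commute mult_cancel_left of_real_eq_iff)
  then have "(W ** rdiag (\<lambda>i. f (d i))) $ i $ j = (rdiag (\<lambda>i. f (e i)) ** W) $ i $ j" for i j
    unfolding rdiag_mult_left rdiag_mult_right by (metis mult.commute mult_zero_right)
  then have W: "W ** rdiag (\<lambda>i. f (d i)) = rdiag (\<lambda>i. f (e i)) ** W"
    by (simp add: vec_eq_iff)
  have "U ** rdiag (\<lambda>i. f (d i)) ** cadjoint U = V ** (W ** rdiag (\<lambda>i. f (d i))) ** cadjoint U"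
    unfolding W_def by (metis VV(2) matrix_mul_assoc matrix_mul_lid)
  also have "\<dots> = V ** rdiag (\<lambda>i. f (e i)) ** cadjoint V"
    unfolding W unfolding W_def by (metis UU(2) matrix_mul_assoc matrix_mul_rid)
  finally show ?thesis .
qed

lemma mpow_eqI:
  assumes "unitary U" "\<And>i. 0 < d i" "A = U ** rdiag d ** cadjoint U"
  shows "mpow A t = U ** rdiag (\<lambda>i. d i powr t) ** cadjoint U"
  unfolding mpow_def
proof (rule the_equality, goal_cases)
  case 1
  then show ?case using assms by blast
next
  case (2 B)
  then obtain V e where V: "unitary V" "A = V ** rdiag e ** cadjoint V"
    and B: "B = V ** rdiag (\<lambda>i. e i powr t) ** cadjoint V"
    by blast
  show ?case
    unfolding B by (rule spectral_calculus_unique) (use assms V in auto)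
qed

definition mat_divide :: "complex^'n^'n \<Rightarrow> complex \<Rightarrow> complex^'n^'n" (infixl "'/\<^sub>m" 70) where
  "A /\<^sub>m c = map_matrix (\<lambda>z. z / c) A"

section \<open>The gyrovector space of invertible density matrices\<close>

definition density_matrices :: "(complex^'n^'n) set" where
  "density_matrices = {\<rho>. positive_definite \<rho> \<and> trace \<rho> = 1}"

definition gyroadd :: "complex^'n^'n \<Rightarrow> complex^'n^'n \<Rightarrow> complex^'n^'n" (infixl "\<odot>" 65) where
  "\<rho> \<odot> \<sigma> = (mpow \<rho> (1/2) ** \<sigma> ** mpow \<rho> (1/2)) /\<^sub>m trace (\<rho> ** \<sigma>)"

definition gyroscale :: "real \<Rightarrow> complex^'n^'n \<Rightarrow> complex^'n^'n" (infixr "\<star>" 75) where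
  "t \<star> \<rho> = mpow \<rho> t /\<^sub>m trace (mpow \<rho> t)"

definition gyroneg :: "complex^'n^'n \<Rightarrow> complex^'n^'n" ("\<ominus> _" [81] 80) where
  "\<ominus> \<rho> = (-1) \<star> \<rho>"

definition gyr :: "complex^'n^'n \<Rightarrow> complex^'n^'n \<Rightarrow> complex^'n^'n \<Rightarrow> complex^'n^'n" where
  "gyr \<rho> \<sigma> \<tau> = (\<ominus> (\<rho> \<odot> \<sigma>)) \<odot> (\<rho> \<odot> (\<sigma> \<odot> \<tau>))"

definition gyrocoadd :: "complex^'n^'n \<Rightarrow> complex^'n^'n \<Rightarrow> complex^'n^'n" (infixl "\<boxdot>" 65) where
  "\<rho> \<boxdot> \<sigma> = \<rho> \<odot> gyr \<rho> (\<ominus> \<sigma>) \<sigma>"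

definition gyroline :: "real \<Rightarrow> complex^'n^'n \<Rightarrow> complex^'n^'n \<Rightarrow> complex^'n^'n" where
  "gyroline t \<rho> \<sigma> = \<rho> \<odot> (t \<star> ((\<ominus> \<rho>) \<odot> \<sigma>))"

definition cogyroline :: "real \<Rightarrow> complex^'n^'n \<Rightarrow> complex^'n^'n \<Rightarrow> complex^'n^'n" where
  "cogyroline t \<rho> \<sigma> = (t \<star> ((\<ominus> \<rho>) \<boxdot> \<sigma>)) \<odot> \<rho>"

section \<open>Geometric means\<close>

definition geom_mean :: "real \<Rightarrow> complex^'n^'n \<Rightarrow> complex^'n^'n \<Rightarrow> complex^'n^'n" where
  "geom_mean t A B =
     mpow A (1/2) ** mpow (mpow A (-1/2) ** B ** mpow A (-1/2)) t ** mpow A (1/2)"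

definition spectral_geom_mean :: "real \<Rightarrow> complex^'n^'n \<Rightarrow> complex^'n^'n \<Rightarrow> complex^'n^'n" where
  "spectral_geom_mean t A B =
     mpow (geom_mean (1/2) (matrix_inv A) B) t ** A ** mpow (geom_mean (1/2) (matrix_inv A) B) t"

end

theory Submission
  imports Defs
begin

text \<open>Up to positive scalars, \<open>\<rho> \<odot> \<sigma>\<close> is \<open>\<rho>\<^sup>1\<^sup>/\<^sup>2 \<sigma> \<rho>\<^sup>1\<^sup>/\<^sup>2\<close> and
  \<open>t \<star> \<rho>\<close> is \<open>\<rho>\<^sup>t\<close>; since powers are homogeneous, all the scalars collect
  into one final normalization of the trace. The gyroline is then the weighted geometric mean verbatim. For the
  cogyroline, put \<open>X = \<rho>\<^sup>1\<^sup>/\<^sup>2 \<sigma> \<rho>\<^sup>1\<^sup>/\<^sup>2\<close>: up to a scalar,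
  \<open>gyr[\<ominus>\<rho>, \<ominus>\<sigma>]\<sigma>\<close> is \<open>X\<^sup>1\<^sup>/\<^sup>2 \<rho>\<^sup>-\<^sup>1 X\<^sup>1\<^sup>/\<^sup>2\<close>, so
  \<open>\<ominus>\<rho> \<boxdot> \<sigma>\<close> is the square of
  \<open>\<rho>\<^sup>-\<^sup>1\<^sup>/\<^sup>2 X\<^sup>1\<^sup>/\<^sup>2 \<rho>\<^sup>-\<^sup>1\<^sup>/\<^sup>2 = \<rho>\<^sup>-\<^sup>1 # \<sigma>\<close>. Powers of a positive definite
  matrix are accessible through the spectral theorem, proved by maximizing the Rayleigh quotient on the orthogonal
  complement of the eigenvectors already found.\<close>

section \<open>The spectral theorem\<close>

text \<open>A maximizer \<open>v\<close> of the Rayleigh quotient on the compact unit sphere of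
  \<open>S\<close> must be an eigenvector: a nonzero residual \<open>c *\<^sub>R v - f v\<close>,
  which invariance keeps in \<open>S\<close>, would give a direction of increase.\<close>

lemma self_adjoint_eigenvector_exists:
  fixes f :: "'a::euclidean_space \<Rightarrow> 'a"
  assumes f: "linear f" and sa: "\<And>x y. f x \<bullet> y = x \<bullet> f y"
    and S: "subspace S" and inv: "f ` S \<subseteq> S" and ne: "S \<noteq> {0}"
  obtains v c where "v \<in> S" "norm v = 1" "f v = c *\<^sub>R v"
proof -
  define K where "K = S \<inter> sphere 0 1"
  have "compact K"
    unfolding K_def using closed_subspace[OF S] by (simp add: closed_Int_compact)
  obtain x where x: "x \<in> S" "x \<noteq> 0" using ne subspace_0[OF S] by blast
  have normed: "(1 / norm z) *\<^sub>R z \<in> K" if "z \<in> S" "z \<noteq> 0" for z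
    using that subspace_scale[OF S] by (simp add: K_def)
  have "K \<noteq> {}" using normed[OF x] by auto
  have "continuous_on K (\<lambda>x. x \<bullet> f x)"
    by (intro continuous_intros linear_continuous_on) (use f linear_conv_bounded_linear in blast)
  then obtain v where v: "v \<in> K" and mx: "\<And>y. y \<in> K \<Longrightarrow> y \<bullet> f y \<le> v \<bullet> f v"
    using continuous_attains_sup[OF \<open>compact K\<close> \<open>K \<noteq> {}\<close>] by blast
  define c where "c = v \<bullet> f v"
  \<comment> \<open>Maximality of \<open>c\<close> on the unit sphere, made homogeneous, says that
    \<open>q\<close> is nonnegative on \<open>S\<close>.\<close>
  define q where "q z = c * (z \<bullet> z) - z \<bullet> f z" for z
  have vS: "v \<in> S" and vn: "norm v = 1" "v \<bullet> v = 1"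
    using v by (auto simp: K_def norm_eq_1)
  have q0: "0 \<le> q z" if "z \<in> S" for z
  proof (cases "z = 0")
    case False
    have "(1 / norm z) *\<^sub>R z \<bullet> f ((1 / norm z) *\<^sub>R z) \<le> c"
      using mx[OF normed[OF that False]] by (simp add: c_def)
    then have "(z \<bullet> f z) / (z \<bullet> z) \<le> c"
      by (simp add: linear_cmul[OF f] power2_eq_square[symmetric] power2_norm_eq_inner power_divide)
    then show ?thesis using False by (simp add: q_def divide_le_eq)
  qed (simp add: q_def linear_0[OF f])
  define w where "w = c *\<^sub>R v - f v"
  have wS: "w \<in> S"
    unfolding w_def using vS inv by (auto intro!: subspace_diff subspace_scale S)
  have qv: "q v = 0" using vn by (simp add: q_def c_def)
  \<comment> \<open>The nonnegative form \<open>q\<close> vanishes at \<open>v\<close>, so its first variation in the direction \<open>w\<close>,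
    which is \<open>2 (w \<bullet> w)\<close>, vanishes.\<close>
  have expand: "q (v + s *\<^sub>R w) = 2 * s * (w \<bullet> w) + s\<^sup>2 * q w" for s
  proof -
    have "q (v + s *\<^sub>R w) = q v + 2 * s * ((c *\<^sub>R v - f v) \<bullet> w) + s\<^sup>2 * q w"
      using sa[of v w]
      by (simp add: q_def linear_add[OF f] linear_cmul[OF f] inner_simps power2_eq_square
          inner_commute algebra_simps)
    then show ?thesis by (simp add: qv w_def)
  qed
  have "w \<bullet> w = 0"
  proof (rule ccontr)
    assume "w \<bullet> w \<noteq> 0"
    then have pos: "0 < w \<bullet> w" by simp
    \<comment> \<open>A negative step, short enough that the quadratic term cannot offset the linear
      one; the \<open>+ 1\<close> keeps the denominator positive even if
      \<open>q w = 0\<close>.\<close>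
    define s where "s = - (w \<bullet> w) / (q w + 1)"
    have qw: "0 \<le> q w" using q0[OF wS] .
    then have sneg: "s < 0" using pos by (simp add: s_def divide_neg_pos)
    have "s * q w \<ge> - (w \<bullet> w)"
    proof -
      have "(w \<bullet> w) * (q w / (q w + 1)) \<le> (w \<bullet> w) * 1"
        using pos qw by (intro mult_left_mono) auto
      then show ?thesis by (simp add: s_def)
    qed
    then have "2 * (w \<bullet> w) + s * q w > 0" using pos by linarith
    then have "s * (2 * (w \<bullet> w) + s * q w) < 0" using sneg by (simp add: mult_neg_pos)
    moreover have "0 \<le> q (v + s *\<^sub>R w)"
      using q0 vS wS by (simp add: subspace_add subspace_scale S)
    ultimately show False by (simp add: expand power2_eq_square algebra_simps)
  qed
  then have "f v = c *\<^sub>R v" by (simp add: w_def)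
  then show ?thesis using that vS vn by blast
qed

section \<open>Hermitian inner product and orthonormal eigenvectors\<close>

definition cdot :: "complex^'n \<Rightarrow> complex^'n \<Rightarrow> complex" where
  "cdot x y = (\<Sum>i\<in>UNIV. cnj (x $ i) * y $ i)"

text \<open>Lets the real eigenvector lemma act on complex vectors: a Hermitian matrix is
  self-adjoint for the real inner product too, and the eigenvalues it yields are real.\<close>

lemma Re_cdot: "Re (cdot x y) = x \<bullet> y"
  by (simp add: cdot_def inner_vec_def inner_complex_def)

lemma cnj_cdot: "cnj (cdot x y) = cdot y x"
  by (simp add: cdot_def mult.commute)

lemma cdot_self: "cdot x x = complex_of_real (x \<bullet> x)"
proof -
  have "Im (cdot x x) = 0" by (simp add: cdot_def algebra_simps)
  then show ?thesis by (simp add: complex_eq_iff Re_cdot)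
qed

lemma cdot_simps:
  "cdot x (y + z) = cdot x y + cdot x z"
  "cdot x (r *\<^sub>R y) = of_real r * cdot x y"
  "cdot (r *\<^sub>R x) y = of_real r * cdot x y"
  "cdot x 0 = 0"
  by (simp_all add: cdot_def algebra_simps sum.distrib sum_distrib_left scaleR_conv_of_real[where 'a = complex])

lemma cadjoint_nth [simp]: "cadjoint A $ i $ j = cnj (A $ j $ i)"
  by (simp add: cadjoint_def map_matrix_def transpose_def)

lemma cdot_cadjoint: "cdot (cadjoint A *v x) y = cdot x (A *v y)"
  unfolding cdot_def matrix_vector_mult_def
  by (simp add: sum_distrib_left sum_distrib_right) (subst sum.swap, simp add: mult_ac)

lemma cdot_hermitian: "hermitian A \<Longrightarrow> cdot (A *v x) y = cdot x (A *v y)"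
  using cdot_cadjoint[of A x y] by (simp add: hermitian_def)

text \<open>The type \<open>'n\<close> counts the dimension, so omitting the index \<open>k\<close>
  leaves too few vectors to span.\<close>

lemma exists_orthogonal_vector:
  fixes u :: "'n \<Rightarrow> complex^'n"
  assumes "k \<notin> I"
  obtains x where "x \<noteq> 0" "\<forall>j\<in>I. cdot (u j) x = 0"
proof -
  define B :: "complex^'n^'n" where "B = (\<chi> j i. if j \<in> I then cnj (u j $ i) else 0)"
  \<comment> \<open>Row \<open>k\<close> of \<open>B\<close> vanishes, so \<open>B\<close> is
    singular, and its kernel supplies the orthogonal vector.\<close>
  have "(B ** C) $ k $ k = 0" for C using assms by (simp add: B_def matrix_matrix_mult_def)
  then have "B ** C \<noteq> mat 1" for C by (force simp: mat_def dest: arg_cong[where f = "\<lambda>M. M $ k $ k"])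
  then have "\<not> (\<exists>C. C ** B = mat 1)" using matrix_left_right_inverse by blast
  then obtain x where x: "B *v x = 0" "x \<noteq> 0" using matrix_left_invertible_ker by blast
  have "cdot (u j) x = 0" if "j \<in> I" for j
  proof -
    have "cdot (u j) x = (B *v x) $ j"
      using that by (simp add: cdot_def B_def matrix_vector_mult_def)
    then show ?thesis using x by simp
  qed
  then show ?thesis using that x by blast
qed

text \<open>Induction on \<open>I\<close>, splitting off one eigenvector at a time. Indexing by
  elements of \<open>'n\<close> makes the family for \<open>UNIV\<close> the columns of a square
  matrix.\<close>

lemma hermitian_orthonormal_eigenvectors:
  fixes A :: "complex^'n^'n" and I :: "'n set"
  assumes A: "hermitian A"
  shows "\<exists>(u :: 'n \<Rightarrow> complex^'n) c. (\<forall>i\<in>I. \<forall>j\<in>I. cdot (u i) (u j) = (if i = j then 1 else 0))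
    \<and> (\<forall>i\<in>I. A *v u i = c i *\<^sub>R u i)"
  using finite_class.finite[of I]
proof (induction I rule: finite_induct)
  case empty
  then show ?case by simp
next
  case (insert k I)
  from insert.IH obtain u :: "'n \<Rightarrow> complex^'n" and c
    where on: "\<forall>i\<in>I. \<forall>j\<in>I. cdot (u i) (u j) = (if i = j then 1 else 0)"
      and ev: "\<forall>i\<in>I. A *v u i = c i *\<^sub>R u i"
    by (elim exE conjE)
  define S where "S = {x. \<forall>j\<in>I. cdot (u j) x = 0}"
  have "subspace S" by (auto simp: S_def subspace_def cdot_simps)
  moreover have "S \<noteq> {0}"
  proof -
    obtain x where "x \<noteq> 0" "\<forall>j\<in>I. cdot (u j) x = 0"
      using exists_orthogonal_vector[OF insert(2)] .
    then have "x \<in> S" "x \<noteq> 0" by (simp_all add: S_def)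
    then show ?thesis by blast
  qed
  moreover have "(*v) A ` S \<subseteq> S"
  proof (rule image_subsetI)
    fix x assume "x \<in> S"
    \<comment> \<open>Moving \<open>A\<close> onto the eigenvector \<open>u j\<close> shows that the
      orthogonal complement is invariant.\<close>
    moreover have "cdot (u j) (A *v x) = c j * cdot (u j) x" if "j \<in> I" for j
      using that ev by (simp add: cdot_simps flip: cdot_hermitian[OF A, of "u j" x])
    ultimately show "A *v x \<in> S" by (simp add: S_def)
  qed
  moreover have "(A *v x) \<bullet> y = x \<bullet> (A *v y)" for x y
    using arg_cong[OF cdot_hermitian[OF A, of x y], of Re] by (simp add: Re_cdot)
  ultimately obtain v d where v: "v \<in> S" "norm v = 1" "A *v v = d *\<^sub>R v"
    using self_adjoint_eigenvector_exists[OF matrix_vector_mul_linear[of A]] by metis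
  have "cdot v v = 1" using v by (simp add: cdot_self norm_eq_1)
  moreover have uv: "cdot (u j) v = 0" if "j \<in> I" for j using v that by (simp add: S_def)
  moreover have "cdot v (u j) = 0" if "j \<in> I" for j
    using arg_cong[OF uv[OF that], of cnj] by (simp add: cnj_cdot)
  ultimately have "\<forall>i\<in>insert k I. \<forall>j\<in>insert k I.
      cdot ((u(k := v)) i) ((u(k := v)) j) = (if i = j then 1 else 0)"
    using on by simp
  moreover have "\<forall>i\<in>insert k I. A *v (u(k := v)) i = (c(k := d)) i *\<^sub>R (u(k := v)) i"
    using ev v(3) by simp
  ultimately show ?case by blast
qed

lemma hermitian_spectral:
  fixes A :: "complex^'n^'n"
  assumes "hermitian A"
  obtains U d where "unitary U" "A = U ** rdiag d ** cadjoint U"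
proof -
  obtain u :: "'n \<Rightarrow> complex^'n" and d where on: "\<And>i j. cdot (u i) (u j) = (if i = j then 1 else 0)"
    and ev: "\<And>i. A *v u i = d i *\<^sub>R u i"
    using hermitian_orthonormal_eigenvectors[OF assms, of UNIV] by auto
  define U :: "complex^'n^'n" where "U = (\<chi> a i. u i $ a)"
  have "cadjoint U ** U = mat 1"
    using on by (simp add: vec_eq_iff matrix_matrix_mult_def U_def cdot_def mat_def)
  then have U: "cadjoint U ** U = mat 1" "U ** cadjoint U = mat 1"
    using matrix_left_right_inverse by blast+
  have "(A ** U) $ a $ i = (U ** rdiag d) $ a $ i" for a i
  proof -
    have "(A ** U) $ a $ i = (A *v u i) $ a"
      by (simp add: matrix_matrix_mult_def matrix_vector_mult_def U_def)
    then show ?thesis by (simp add: ev rdiag_mult_right U_def scaleR_conv_of_real[where 'a = complex] mult.commute)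
  qed
  then have "A ** U = U ** rdiag d" by (simp add: vec_eq_iff)
  then have "A = U ** rdiag d ** cadjoint U"
    by (metis U(2) matrix_mul_assoc matrix_mul_rid)
  then show ?thesis using that U by (auto simp: unitary_def)
qed

section \<open>Positive definiteness under congruence and diagonalization\<close>

lemma cadjoint_mult: "cadjoint (A ** B) = cadjoint B ** cadjoint A"
  by (simp add: vec_eq_iff matrix_matrix_mult_def mult.commute)

lemma cadjoint_cadjoint [simp]: "cadjoint (cadjoint A) = A"
  by (simp add: vec_eq_iff)

lemma cadjoint_rdiag [simp]: "cadjoint (rdiag d) = rdiag d"
  by (auto simp: vec_eq_iff rdiag_def)

lemma positive_definite_iff_cdot:
  "positive_definite A \<longleftrightarrow> hermitian A \<and> (\<forall>x. x \<noteq> 0 \<longrightarrow> 0 < Re (cdot x (A *v x)))"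
  by (simp add: positive_definite_def cdot_def)

lemma positive_definite_hermitian: "positive_definite A \<Longrightarrow> hermitian A"
  by (simp add: positive_definite_def)

text \<open>The form of the product at \<open>x\<close> is the form of \<open>A\<close> at
  \<open>M *v x\<close>, and the left inverse \<open>N\<close> keeps \<open>M *v x\<close>
  nonzero.\<close>

lemma positive_definite_congruence:
  assumes A: "positive_definite A" and inv: "N ** M = mat 1"
  shows "positive_definite (cadjoint M ** A ** M)"
proof -
  have "hermitian (cadjoint M ** A ** M)"
    using A by (simp add: positive_definite_iff_cdot hermitian_def cadjoint_mult matrix_mul_assoc)
  moreover have "0 < Re (cdot x ((cadjoint M ** A ** M) *v x))" if "x \<noteq> 0" for x
  proof -
    have "M *v x \<noteq> 0"
      using that inv by (metis matrix_left_invertible_ker)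
    then have "0 < Re (cdot (M *v x) (A *v (M *v x)))"
      using A by (simp add: positive_definite_iff_cdot)
    also have "cdot (M *v x) (A *v (M *v x)) = cdot x ((cadjoint M ** A ** M) *v x)"
      using cdot_cadjoint[of "cadjoint M" x] by (simp flip: matrix_vector_mul_assoc)
    finally show ?thesis .
  qed
  ultimately show ?thesis by (simp add: positive_definite_iff_cdot)
qed

lemma positive_definite_rdiag: "positive_definite (rdiag d) \<longleftrightarrow> (\<forall>i. 0 < d i)"
proof -
  have form: "Re (cdot x (rdiag d *v x)) = (\<Sum>i\<in>UNIV. d i * (norm (x $ i))\<^sup>2)" for x
    by (simp add: cdot_def rdiag_def matrix_vector_mult_def if_distrib if_distribR cong: if_cong)
      (simp add: cmod_power2, simp add: power2_eq_square algebra_simps)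
  show ?thesis
  proof
    assume "positive_definite (rdiag d)"
    then have "0 < Re (cdot (axis k 1) (rdiag d *v axis k 1))" for k
      by (simp add: positive_definite_iff_cdot)
    then have "0 < d k" for k
      unfolding form by (simp add: axis_def if_distrib if_distribR cong: if_cong)
    then show "\<forall>i. 0 < d i" by blast
  next
    assume d: "\<forall>i. 0 < d i"
    have "0 < Re (cdot x (rdiag d *v x))" if "x \<noteq> 0" for x
    proof -
      obtain k where "x $ k \<noteq> 0" using \<open>x \<noteq> 0\<close> unfolding vec_eq_iff by auto
      then show ?thesis
        unfolding form using d by (intro sum_pos2[of _ k]) (auto simp: less_imp_le)
    qed
    then show "positive_definite (rdiag d)"
      by (simp add: positive_definite_iff_cdot hermitian_def)
  qed
qed

lemma positive_definite_unitary_rdiag: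
  assumes U: "unitary U"
  shows "positive_definite (U ** rdiag d ** cadjoint U) \<longleftrightarrow> (\<forall>i. 0 < d i)"
proof
  assume "positive_definite (U ** rdiag d ** cadjoint U)"
  then have "positive_definite (cadjoint U ** (U ** rdiag d ** cadjoint U) ** U)"
    using U by (auto simp: unitary_def intro: positive_definite_congruence)
  moreover have "cadjoint U ** (U ** rdiag d ** cadjoint U) ** U = rdiag d"
    using U unfolding unitary_def by (metis matrix_mul_assoc matrix_mul_lid matrix_mul_rid)
  ultimately show "\<forall>i. 0 < d i" by (simp add: positive_definite_rdiag)
next
  assume "\<forall>i. 0 < d i"
  then show "positive_definite (U ** rdiag d ** cadjoint U)"
    using U positive_definite_congruence[of "rdiag d" U "cadjoint U"]
    by (simp add: positive_definite_rdiag unitary_def)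
qed

text \<open>One pair \<open>U\<close>, \<open>d\<close> serves all exponents at once, so the power
  laws below reduce to laws of \<open>powr\<close> on the diagonal.\<close>

lemma positive_definite_spectral:
  fixes A :: "complex^'n^'n"
  assumes "positive_definite A"
  obtains U d where "unitary U" "\<forall>i. 0 < d i" "A = U ** rdiag d ** cadjoint U"
    "\<forall>t. mpow A t = U ** rdiag (\<lambda>i. d i powr t) ** cadjoint U"
proof -
  obtain U d where U: "unitary U" "A = U ** rdiag d ** cadjoint U"
    using hermitian_spectral positive_definite_hermitian[OF assms] .
  then have d: "0 < d i" for i using positive_definite_unitary_rdiag assms by blast
  show ?thesis
    by (rule that[of U d]) (use U d mpow_eqI[OF U(1) d U(2)] in auto)
qed

section \<open>Powers of positive definite matrices\<close>

lemma rdiag_mult: "rdiag d ** rdiag e = rdiag (\<lambda>i. d i * e i)"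
  by (simp add: vec_eq_iff rdiag_mult_left) (simp add: rdiag_def)

lemma rdiag_one [simp]: "rdiag (\<lambda>i. 1) = mat 1"
  by (simp add: vec_eq_iff rdiag_def mat_def)

lemma rdiag_scaleR: "rdiag (\<lambda>i. c * d i) = c *\<^sub>R rdiag d"
  by (simp add: vec_eq_iff rdiag_def scaleR_conv_of_real[where 'a = complex])

lemma mpow_positive_definite:
  assumes "positive_definite A" shows "positive_definite (mpow A t)"
proof -
  obtain U d where U: "unitary U" and d: "\<forall>i. 0 < d i" and A: "A = U ** rdiag d ** cadjoint U"
    and m: "\<forall>t. mpow A t = U ** rdiag (\<lambda>i. d i powr t) ** cadjoint U"
    using positive_definite_spectral[OF assms] .
  note d = d[rule_format] and m = m[rule_format]
  have "0 < d i powr t" for i using d[of i] by simp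
  then show ?thesis using U m by (simp add: positive_definite_unitary_rdiag)
qed

lemma mpow_add:
  assumes "positive_definite A" shows "mpow A s ** mpow A t = mpow A (s + t)"
proof -
  obtain U d where U: "unitary U" and d: "\<forall>i. 0 < d i" and A: "A = U ** rdiag d ** cadjoint U"
    and m: "\<forall>t. mpow A t = U ** rdiag (\<lambda>i. d i powr t) ** cadjoint U"
    using positive_definite_spectral[OF assms] .
  note d = d[rule_format] and m = m[rule_format]
  have "mpow A s ** mpow A t = U ** (rdiag (\<lambda>i. d i powr s) ** rdiag (\<lambda>i. d i powr t)) ** cadjoint U"
  proof -
    have "mpow A s ** mpow A t = U ** rdiag (\<lambda>i. d i powr s) ** (cadjoint U ** U)
        ** rdiag (\<lambda>i. d i powr t) ** cadjoint U"
      unfolding m by (simp add: matrix_mul_assoc)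
    also have "cadjoint U ** U = mat 1" using U by (simp add: unitary_def)
    finally show ?thesis by (simp add: matrix_mul_assoc)
  qed
  then show ?thesis by (simp add: m rdiag_mult powr_add)
qed

lemma mpow_one: assumes "positive_definite A" shows "mpow A 1 = A"
proof -
  obtain U d where U: "unitary U" and d: "\<forall>i. 0 < d i" and A: "A = U ** rdiag d ** cadjoint U"
    and m: "\<forall>t. mpow A t = U ** rdiag (\<lambda>i. d i powr t) ** cadjoint U"
    using positive_definite_spectral[OF assms] .
  note d = d[rule_format] and m = m[rule_format]
  have "d i powr 1 = d i" for i using d[of i] by simp
  then show ?thesis unfolding m[of 1] A[symmetric] by (simp flip: A)
qed

lemma mpow_zero: assumes "positive_definite A" shows "mpow A 0 = mat 1"
proof -
  obtain U d where U: "unitary U" and d: "\<forall>i. 0 < d i" and A: "A = U ** rdiag d ** cadjoint U"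
    and m: "\<forall>t. mpow A t = U ** rdiag (\<lambda>i. d i powr t) ** cadjoint U"
    using positive_definite_spectral[OF assms] .
  note d = d[rule_format] and m = m[rule_format]
  have "d i powr 0 = 1" for i using d[of i] by simp
  then show ?thesis using U m[of 0] by (simp add: unitary_def)
qed

text \<open>The formula for \<open>mpow A s\<close> is itself a unitary diagonalization with
  positive entries, so \<open>mpow_eqI\<close> applies to it again.\<close>

lemma mpow_mpow:
  assumes "positive_definite A" shows "mpow (mpow A s) t = mpow A (s * t)"
proof -
  obtain U d where U: "unitary U" and d: "\<forall>i. 0 < d i" and A: "A = U ** rdiag d ** cadjoint U"
    and m: "\<forall>t. mpow A t = U ** rdiag (\<lambda>i. d i powr t) ** cadjoint U"
    using positive_definite_spectral[OF assms] .
  note d = d[rule_format] and m = m[rule_format]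
  have "mpow (mpow A s) t = U ** rdiag (\<lambda>i. (d i powr s) powr t) ** cadjoint U"
  proof (rule mpow_eqI[OF U _ m[of s]])
    show "0 < d i powr s" for i using d[of i] by simp
  qed
  then show ?thesis unfolding m[of "s * t"] powr_powr .
qed

lemma mpow_scaleR:
  assumes "positive_definite A" "0 < c" shows "mpow (c *\<^sub>R A) t = (c powr t) *\<^sub>R mpow A t"
proof -
  obtain U d where U: "unitary U" and d: "\<forall>i. 0 < d i" and A: "A = U ** rdiag d ** cadjoint U"
    and m: "\<forall>t. mpow A t = U ** rdiag (\<lambda>i. d i powr t) ** cadjoint U"
    using positive_definite_spectral[OF assms(1)] .
  note d = d[rule_format] and m = m[rule_format]
  have "c *\<^sub>R A = U ** rdiag (\<lambda>i. c * d i) ** cadjoint U"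
    by (simp add: A rdiag_scaleR matrix_scalar_ac flip: scalar_matrix_assoc)
  then have "mpow (c *\<^sub>R A) t = U ** rdiag (\<lambda>i. (c * d i) powr t) ** cadjoint U"
    using mpow_eqI[OF U, of "\<lambda>i. c * d i"] d assms(2) by simp
  also have "rdiag (\<lambda>i. (c * d i) powr t) = (c powr t) *\<^sub>R rdiag (\<lambda>i. d i powr t)"
    using d assms(2) by (simp add: powr_mult less_imp_le rdiag_scaleR)
  finally show ?thesis by (simp add: m matrix_scalar_ac flip: scalar_matrix_assoc)
qed

lemma mpow_inverse:
  assumes "positive_definite A"
  shows "mpow A (- t) ** mpow A t = mat 1" "mpow A t ** mpow A (- t) = mat 1"
  using assms by (simp_all add: mpow_add mpow_zero)

lemma left_inverse_eq_right_inverse: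
  fixes A B C :: "'a::semiring_1^'n^'n"
  assumes "B ** A = mat 1" "A ** C = mat 1" shows "B = C"
proof -
  have "B = B ** (A ** C)" by (simp add: assms(2))
  also have "\<dots> = C" by (simp add: matrix_mul_assoc assms(1))
  finally show ?thesis .
qed

lemma matrix_inv_mpow:
  assumes "positive_definite A" shows "matrix_inv A = mpow A (- 1)"
proof -
  have inv: "A ** mpow A (- 1) = mat 1" "mpow A (- 1) ** A = mat 1"
    using mpow_inverse[OF assms, of 1] assms by (simp_all add: mpow_one)
  \<comment> \<open>\<open>matrix_inv\<close> is a choice among two-sided inverses;
    \<open>mpow A (- 1)\<close> witnesses that one exists.\<close>
  then have "matrix_inv A ** A = mat 1"
    unfolding matrix_inv_def using someI[of "\<lambda>B. A ** B = mat 1 \<and> B ** A = mat 1"] by blast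
  then show ?thesis using inv(1) by (rule left_inverse_eq_right_inverse)
qed

lemma positive_definite_mpow_congruence:
  assumes "positive_definite A" "positive_definite B"
  shows "positive_definite (mpow A t ** B ** mpow A t)"
  using positive_definite_congruence[OF assms(2) mpow_inverse(1)[OF assms(1)]]
    positive_definite_hermitian[OF mpow_positive_definite[OF assms(1)]]
  by (simp add: hermitian_def)

text \<open>Normalizing the trace therefore multiplies by a positive real, which keeps positive
  definiteness and passes through powers.\<close>

lemma positive_definite_trace:
  assumes "positive_definite A" shows "trace A = of_real (Re (trace A))" "0 < Re (trace A)"
proof -
  have A: "hermitian A" using assms by (rule positive_definite_hermitian)
  have "cnj (A $ i $ i) = A $ i $ i" for i
    using A unfolding hermitian_def by (metis cadjoint_nth)
  then have "cnj (trace A) = trace A" by (simp add: trace_def)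
  then show "trace A = of_real (Re (trace A))"
    by (simp add: complex_eq_iff)
  have "0 < Re (cdot (axis i 1) (A *v axis i 1))" for i
    using assms by (simp add: positive_definite_iff_cdot)
  moreover have "cdot (axis i 1) (A *v axis i 1) = A $ i $ i" for i
    by (simp add: cdot_def axis_def matrix_vector_mult_def if_distrib if_distribR cong: if_cong)
  ultimately show "0 < Re (trace A)"
    by (auto simp: trace_def intro!: sum_pos)
qed

section \<open>Gyrovector operations up to positive scalars\<close>

text \<open>For positive definite \<open>A\<close>, the density matrix on the ray through
  \<open>A\<close>; computing on rays lets intermediate scalars be dropped.\<close>

definition unit_trace :: "complex^'n^'n \<Rightarrow> complex^'n^'n" where
  "unit_trace A = A /\<^sub>m trace A"

lemma unit_trace_scaleR:
  assumes "c \<noteq> 0" shows "unit_trace (c *\<^sub>R A) = unit_trace A"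
proof -
  have "trace (c *\<^sub>R A) = of_real c * trace A"
    by (simp add: trace_def sum_distrib_left scaleR_conv_of_real[where 'a = complex])
  then show ?thesis
    using assms
    by (simp add: unit_trace_def mat_divide_def map_matrix_def vec_eq_iff scaleR_conv_of_real[where 'a = complex])
qed

lemma unit_trace_eq_scaleR:
  assumes "positive_definite A"
  obtains c where "0 < c" "unit_trace A = c *\<^sub>R A"
proof -
  define r where "r = Re (trace A)"
  have "trace A = of_real r" "0 < r"
    using positive_definite_trace[OF assms] by (simp_all add: r_def)
  then have "unit_trace A = (1 / r) *\<^sub>R A"
    by (simp add: unit_trace_def mat_divide_def map_matrix_def vec_eq_iff scaleR_conv_of_real[where 'a = complex])
  then show ?thesis using that[of "1 / r"] \<open>0 < r\<close> by simp
qed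

lemma positive_definite_scaleR:
  assumes "positive_definite A" "0 < c" shows "positive_definite (c *\<^sub>R A)"
proof -
  have "(c *\<^sub>R A) *v x = c *\<^sub>R (A *v x)" for x
    by (simp add: vec_eq_iff matrix_vector_mult_def scaleR_sum_right)
  moreover have "cadjoint (c *\<^sub>R A) = c *\<^sub>R cadjoint A"
    by (simp add: vec_eq_iff)
  ultimately show ?thesis
    using assms by (simp add: positive_definite_iff_cdot cdot_simps hermitian_def)
qed

lemma density_matrix_unit_trace:
  "\<rho> \<in> density_matrices \<Longrightarrow> positive_definite \<rho> \<and> unit_trace \<rho> = \<rho>"
  by (simp add: density_matrices_def unit_trace_def mat_divide_def map_matrix_def vec_eq_iff)

text \<open>By cyclicity of the trace, the denominator in \<open>\<odot>\<close> is the trace of its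
  numerator.\<close>

lemma gyroadd_eq_unit_trace:
  assumes "positive_definite \<rho>"
  shows "\<rho> \<odot> \<sigma> = unit_trace (mpow \<rho> (1/2) ** \<sigma> ** mpow \<rho> (1/2))"
proof -
  have "trace (mpow \<rho> (1/2) ** \<sigma> ** mpow \<rho> (1/2)) = trace (mpow \<rho> (1/2) ** mpow \<rho> (1/2) ** \<sigma>)"
    by (metis matrix_mul_assoc trace_mul_sym)
  also have "\<dots> = trace (\<rho> ** \<sigma>)" using assms by (simp add: mpow_add mpow_one)
  finally show ?thesis by (simp add: gyroadd_def unit_trace_def)
qed

lemma gyroadd_unit_trace:
  assumes "positive_definite A" "positive_definite B"
  shows "unit_trace A \<odot> unit_trace B = unit_trace (mpow A (1/2) ** B ** mpow A (1/2))"
proof -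
  obtain a where a: "0 < a" "unit_trace A = a *\<^sub>R A" using unit_trace_eq_scaleR[OF assms(1)] .
  obtain b where b: "0 < b" "unit_trace B = b *\<^sub>R B" using unit_trace_eq_scaleR[OF assms(2)] .
  show ?thesis
    using a b assms
    by (simp add: positive_definite_scaleR gyroadd_eq_unit_trace mpow_scaleR matrix_scalar_ac
        unit_trace_scaleR flip: scalar_matrix_assoc)
qed

lemma gyroscale_unit_trace:
  assumes "positive_definite A"
  shows "t \<star> unit_trace A = unit_trace (mpow A t)"
proof -
  obtain a where a: "0 < a" "unit_trace A = a *\<^sub>R A" using unit_trace_eq_scaleR[OF assms] .
  have "t \<star> unit_trace A = unit_trace (mpow (unit_trace A) t)"
    by (simp add: gyroscale_def unit_trace_def)
  then show ?thesis using a assms by (simp add: mpow_scaleR unit_trace_scaleR)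
qed

lemma gyroneg_unit_trace:
  "positive_definite A \<Longrightarrow> \<ominus> (unit_trace A) = unit_trace (mpow A (- 1))"
  by (simp add: gyroneg_def gyroscale_unit_trace)

text \<open>The right-hand side is a left inverse of \<open>?X\<close>, and
  \<open>mpow ?X (- 1)\<close> is a right inverse, so they agree.\<close>

lemma mpow_congruence_inverse:
  assumes "positive_definite A" "positive_definite B"
  shows "mpow (mpow A s ** B ** mpow A s) (- 1) = mpow A (- s) ** mpow B (- 1) ** mpow A (- s)"
    (is "mpow ?X _ = ?Y")
proof -
  have "?Y ** ?X = mpow A (- s) ** mpow B (- 1) ** (mpow A (- s) ** mpow A s) ** B ** mpow A s"
    by (simp add: matrix_mul_assoc)
  also have "\<dots> = mpow A (- s) ** (mpow B (- 1) ** mpow B 1) ** mpow A s"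
    using assms by (simp add: mpow_inverse mpow_one matrix_mul_assoc)
  finally have "?Y ** ?X = mat 1"
    using assms mpow_inverse(1)[of B 1] by (simp add: mpow_inverse)
  moreover have "?X ** mpow ?X (- 1) = mat 1"
    using mpow_inverse(2)[of ?X 1] positive_definite_mpow_congruence[OF assms] by (simp add: mpow_one)
  ultimately show ?thesis by (rule left_inverse_eq_right_inverse[symmetric])
qed

section \<open>Gyrolines and cogyrolines as geometric means\<close>

lemma gyroline_unit_trace:
  assumes "positive_definite A" "positive_definite B"
  shows "gyroline t (unit_trace A) (unit_trace B) = unit_trace (geom_mean t A B)"
  using assms
  by (simp add: gyroline_def geom_mean_def gyroneg_unit_trace gyroadd_unit_trace
      gyroscale_unit_trace mpow_positive_definite mpow_mpow positive_definite_mpow_congruence)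

text \<open>On rays, the inner sum of \<open>mpow B (- 1)\<close> and \<open>B\<close> is the
  identity, so adding it to \<open>A\<close> returns \<open>A\<close>; the outer left summand is the
  inverse of the sum of \<open>A\<close> and \<open>mpow B (- 1)\<close>.\<close>

lemma gyr_inverse_unit_trace:
  fixes A B :: "complex^'n^'n"
  assumes "positive_definite A" "positive_definite B"
  shows "gyr (unit_trace A) (unit_trace (mpow B (- 1))) (unit_trace B)
    = unit_trace (mpow (mpow A (- 1 / 2) ** B ** mpow A (- 1 / 2)) (1/2) ** A
        ** mpow (mpow A (- 1 / 2) ** B ** mpow A (- 1 / 2)) (1/2))"
proof -
  have B: "mpow B (- (1/2)) ** B ** mpow B (- (1/2)) = mat 1"
  proof -
    have "mpow B (- (1/2)) ** mpow B 1 ** mpow B (- (1/2)) = mat 1"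
      unfolding mpow_add[OF assms(2)] using assms(2) by (simp add: mpow_zero)
    then show ?thesis by (simp add: mpow_one assms)
  qed
  have A: "mpow A (1/2) ** mpow A (1/2) = A"
    using assms by (simp add: mpow_add mpow_one)
  \<comment> \<open>Needed to apply \<open>gyroadd_unit_trace\<close> with the identity as right
    summand.\<close>
  have I: "positive_definite (mat 1 :: complex^'n^'n)"
    using mpow_positive_definite[OF assms(1), of 0] assms by (simp add: mpow_zero)
  show ?thesis
    using assms
    by (simp add: gyr_def gyroneg_unit_trace gyroadd_unit_trace gyroscale_unit_trace
        mpow_positive_definite mpow_mpow positive_definite_mpow_congruence I A B
        mpow_congruence_inverse mpow_one)
qed

lemma cogyroline_unit_trace:
  assumes A: "positive_definite A" and B: "positive_definite B"
  shows "cogyroline t (unit_trace A) (unit_trace B) = unit_trace (spectral_geom_mean t A B)"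
proof -
  define X where "X = mpow A (1/2) ** B ** mpow A (1/2)"
  define G where "G = mpow A (-1/2) ** mpow X (1/2) ** mpow A (-1/2)"
  have X: "positive_definite X" unfolding X_def using A B by (rule positive_definite_mpow_congruence)
  have G: "positive_definite G"
    unfolding G_def using A mpow_positive_definite[OF X] by (rule positive_definite_mpow_congruence)
  have mean: "geom_mean (1/2) (matrix_inv A) B = G"
    using A by (simp add: geom_mean_def matrix_inv_mpow mpow_mpow G_def X_def)
  \<comment> \<open>Splitting the middle \<open>mpow A (- 1)\<close> into two factors
    \<open>mpow A (-1/2)\<close> yields two copies of \<open>G\<close>.\<close>
  have "mpow A (-1/2) ** (mpow X (1/2) ** mpow A (- 1) ** mpow X (1/2)) ** mpow A (-1/2) = G ** G"
    using mpow_add[OF A, of "-1/2" "-1/2"] unfolding G_def by (simp flip: matrix_mul_assoc)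
      (simp add: matrix_mul_assoc)
  also have "G ** G = mpow G 2" using mpow_add[OF G, of 1 1] by (simp add: mpow_one G)
  finally have sq: "mpow A (-1/2) ** (mpow X (1/2) ** mpow A (- 1) ** mpow X (1/2)) ** mpow A (-1/2)
    = mpow G 2" .
  \<comment> \<open>\<open>gyr_inverse_unit_trace\<close> is used with \<open>mpow A (- 1)\<close>
    for \<open>A\<close>, whose power \<open>-1/2\<close> is \<open>mpow A (1/2)\<close>; hence
    \<open>X\<close>.\<close>
  have "(\<ominus> (unit_trace A)) \<boxdot> unit_trace B = unit_trace (mpow G 2)"
    using A B X sq
    by (simp add: gyrocoadd_def gyroneg_unit_trace gyr_inverse_unit_trace
        mpow_positive_definite mpow_mpow gyroadd_unit_trace positive_definite_mpow_congruence
        flip: X_def)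
  \<comment> \<open>Scaling by \<open>t\<close> gives the power \<open>2 * t\<close> of
    \<open>G\<close>; the square root in \<open>\<odot>\<close> brings it back to
    \<open>t\<close>.\<close>
  then show ?thesis
    using A G by (simp add: cogyroline_def gyroscale_unit_trace gyroadd_unit_trace mpow_mpow
        mpow_positive_definite spectral_geom_mean_def mean)
qed

theorem theorem4p10:
  fixes \<rho> \<sigma> :: "complex^'n^'n" and t :: real
  assumes "\<rho> \<in> density_matrices" and "\<sigma> \<in> density_matrices" and "t \<in> {0..1}"
  shows "gyroline t \<rho> \<sigma> = geom_mean t \<rho> \<sigma> /\<^sub>m trace (geom_mean t \<rho> \<sigma>)
    \<and> cogyroline t \<rho> \<sigma> = spectral_geom_mean t \<rho> \<sigma> /\<^sub>m trace (spectral_geom_mean t \<rho> \<sigma>)"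
  using gyroline_unit_trace[of \<rho> \<sigma> t] cogyroline_unit_trace[of \<rho> \<sigma> t]
    density_matrix_unit_trace[OF assms(1)] density_matrix_unit_trace[OF assms(2)]
  by (simp add: unit_trace_def)

end
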